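(* Let $X$, $\lambda>0$, $\Omega$ and $\{P_n\}_{n\in\mathbb N}$ be as in the context, satisfying conditions (1)–(6). Then there are constants $c,C>0$ such that for all $f\in X$ and $n\in\mathbb N$ $$c\,\Omega(P_{2^n}(f),2^{-n})_X\le\Omega(f,2^{-n})_X\le C\Big(\sum_{k=n+1}^\infty\Omega(P_{2^k}(f),2^{-k})_X^\lambda\Big)^{1/\lambda}.$$ Moreover, the left-hand inequality holds if one assumes only conditions (2), (3) and (6).
   Context: $\lambda>0$ is fixed and $(X,\rho)$ is a (function) space in which sums and differences are defined, with metric $\rho(f,g)=\|f-g\|_X^\lambda$, where the functional $\|\cdot\|_X:X\to[0,\infty)$ satisfies, for all $f,g\in X$: $\|f\|_X=0$ iff $f=0$; $\|-f\|_X=\|f\|_X$; $\|f+g\|_X^\lambda\le\|f\|_X^\lambda+\|g\|_X^\lambda$. (Homogeneity is not assumed.) $\Omega(\cdot,\cdot)_X:X\times(0,\infty)\to[0,\infty)$ is a functional ("abstract modulus of smoothness") and $P_n:X\to X$, $n\in\mathbb N$, is a family of operators (not necessarily linear). The conditions are, for all $f,g\in X$, $\delta>0$, $n\in\mathbb N$, with constants $C_1,\dots,C_4$ depending only on $X$ and $\lambda$: (1) $\Omega(f,\delta)_X\to0$ as $\delta\to+0$; (2) $\Omega(f,\delta)_X\le C_1\|f\|_X$; (3) $\Omega(f+g,\delta)_X\le C_2(\Omega(f,\delta)_X+\Omega(g,\delta)_X)$; (4) $\Omega(f,2\delta)_X\le C_3\Omega(f,\delta)_X$; (5) $\|f-P_n(f)\|_X\le\|f-P_n(P_{2n}(f))\|_X$;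 (6) $\|f-P_n(f)\|_X\le C_4\Omega(f,n^{-1})_X$. *)

theory Defs
  imports "HOL-Analysis.Analysis"
begin

text \<open>
  The space is a type of class \<^class>\<open>ab_group_add\<close>: no scalar multiplication, homogeneity or
  completeness is assumed. The metric is determined by the functional \<open>N\<close> as
  \<open>N (f - g) powr lam\<close>. Since \<open>0 powr lam = 0\<close>, the real power agrees with the usual one on
  \<open>[0, \<infinity>)\<close> for \<open>lam > 0\<close>.
\<close>

definition abstract_norm :: "real \<Rightarrow> ('a::ab_group_add \<Rightarrow> real) \<Rightarrow> bool" where
  "abstract_norm lam N \<longleftrightarrow>
     (\<forall>f. N f \<ge> 0) \<and>
     (\<forall>f. N f = 0 \<longleftrightarrow> f = 0) \<and>
     (\<forall>f. N (- f) = N f) \<and>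
     (\<forall>f g. N (f + g) powr lam \<le> N f powr lam + N g powr lam)"

text \<open>
  \<open>\<Omega> f \<delta>\<close> is only meaningful for \<open>\<delta> > 0\<close> and \<open>P n\<close> only for \<open>n \<ge> 1\<close>; nothing is required of
  the remaining values.
\<close>

definition modulus_nonneg :: "('a \<Rightarrow> real \<Rightarrow> real) \<Rightarrow> bool" where
  "modulus_nonneg \<Omega> \<longleftrightarrow> (\<forall>f \<delta>. \<delta> > 0 \<longrightarrow> \<Omega> f \<delta> \<ge> 0)"

definition modulus_vanishes :: "('a \<Rightarrow> real \<Rightarrow> real) \<Rightarrow> bool" where
  "modulus_vanishes \<Omega> \<longleftrightarrow> (\<forall>f. (\<Omega> f \<longlongrightarrow> 0) (at_right 0))"

definition modulus_bounded :: "('a \<Rightarrow> real) \<Rightarrow> ('a \<Rightarrow> real \<Rightarrow> real) \<Rightarrow> bool" where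
  "modulus_bounded N \<Omega> \<longleftrightarrow> (\<exists>C. \<forall>f \<delta>. \<delta> > 0 \<longrightarrow> \<Omega> f \<delta> \<le> C * N f)"

definition modulus_quasi_additive :: "('a::ab_group_add \<Rightarrow> real \<Rightarrow> real) \<Rightarrow> bool" where
  "modulus_quasi_additive \<Omega> \<longleftrightarrow>
     (\<exists>C. \<forall>f g \<delta>. \<delta> > 0 \<longrightarrow> \<Omega> (f + g) \<delta> \<le> C * (\<Omega> f \<delta> + \<Omega> g \<delta>))"

definition modulus_doubling :: "('a \<Rightarrow> real \<Rightarrow> real) \<Rightarrow> bool" where
  "modulus_doubling \<Omega> \<longleftrightarrow> (\<exists>C. \<forall>f \<delta>. \<delta> > 0 \<longrightarrow> \<Omega> f (2 * \<delta>) \<le> C * \<Omega> f \<delta>)"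

definition near_best :: "('a::ab_group_add \<Rightarrow> real) \<Rightarrow> (nat \<Rightarrow> 'a \<Rightarrow> 'a) \<Rightarrow> bool" where
  "near_best N P \<longleftrightarrow> (\<forall>f n. n \<ge> 1 \<longrightarrow> N (f - P n f) \<le> N (f - P n (P (2 * n) f)))"

definition jackson_type ::
  "('a::ab_group_add \<Rightarrow> real) \<Rightarrow> ('a \<Rightarrow> real \<Rightarrow> real) \<Rightarrow> (nat \<Rightarrow> 'a \<Rightarrow> 'a) \<Rightarrow> bool" where
  "jackson_type N \<Omega> P \<longleftrightarrow>
     (\<exists>C. \<forall>f n. n \<ge> 1 \<longrightarrow> N (f - P n f) \<le> C * \<Omega> f (1 / real n))"

text \<open>Real power on \<open>[0, \<infinity>]\<close>, for exponents \<open>a > 0\<close>, with the convention \<open>\<infinity>\<^sup>a = \<infinity>\<close>.\<close>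

definition ennreal_powr :: "ennreal \<Rightarrow> real \<Rightarrow> ennreal" where
  "ennreal_powr x a = (if x = top then top else ennreal (enn2real x powr a))"

end

theory Submission
  imports Defs
begin

text \<open>
  The lower bound comes from writing $P_{2^n}(f) = f + (P_{2^n}(f) - f)$ and using the Jackson
  inequality. For the upper bound put $e_k = \|f - P_{2^k}(f)\|$ and $g = P_{2^{k+1}}(f)$. Condition
  (5) bounds $e_k$ by $\|(f - g) + (g - P_{2^k}(g))\|$, so (6) applied to $g$ and doubling give
  $e_k^\lambda \le e_{k+1}^\lambda + K^\lambda\,\Omega(g, 2^{-k-1})^\lambda$. Since $e_m \to 0$ by
  (1) and (6), this telescopes to a bound of $e_{n+1}$ by the tail sum, and
  $\Omega(f, 2^{-n})$ is controlled by $e_{n+1}$ and the first term of the series.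
\<close>

lemma abstract_norm_nonneg: "abstract_norm lam N \<Longrightarrow> N f \<ge> 0"
  by (simp add: abstract_norm_def)

lemma abstract_norm_minus_commute: "abstract_norm lam N \<Longrightarrow> N (f - g) = N (g - f)"
  unfolding abstract_norm_def by (metis minus_diff_eq)

lemma abstract_norm_triangle:
  "abstract_norm lam N \<Longrightarrow> N (f + g) powr lam \<le> N f powr lam + N g powr lam"
  by (simp add: abstract_norm_def)

text \<open>The conditions only provide some real constant, possibly negative. Since the factor it
  multiplies is nonnegative, it may be raised to \<open>max C 1\<close>, and the positivity gained
  allows inequalities to be multiplied by the constant later. The next three lemmas use the same
  device.\<close>

lemma modulus_boundedE:
  assumes "abstract_norm lam N" "modulus_bounded N \<Omega>"
  obtains C where "C > 0" "\<And>f \<delta>. \<delta> > 0 \<Longrightarrow> \<Omega> f \<delta> \<le> C * N f"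
proof -
  obtain C where C: "\<And>f \<delta>. \<delta> > 0 \<Longrightarrow> \<Omega> f \<delta> \<le> C * N f"
    using assms(2) unfolding modulus_bounded_def by blast
  show ?thesis
  proof (rule that [of "max C 1"])
    show "\<Omega> f \<delta> \<le> max C 1 * N f" if "\<delta> > 0" for f \<delta>
      using C [OF that, of f] mult_right_mono [OF max.cobounded1 abstract_norm_nonneg [OF assms(1)]]
      by (rule order_trans)
  qed simp
qed

lemma modulus_quasi_additiveE:
  assumes "modulus_nonneg \<Omega>" "modulus_quasi_additive \<Omega>"
  obtains C where "C > 0" "\<And>f g \<delta>. \<delta> > 0 \<Longrightarrow> \<Omega> (f + g) \<delta> \<le> C * (\<Omega> f \<delta> + \<Omega> g \<delta>)"
proof -
  obtain C where C: "\<And>f g \<delta>. \<delta> > 0 \<Longrightarrow> \<Omega> (f + g) \<delta> \<le> C * (\<Omega> f \<delta> + \<Omega> g \<delta>)"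
    using assms(2) unfolding modulus_quasi_additive_def by blast
  show ?thesis
  proof (rule that [of "max C 1"])
    show "\<Omega> (f + g) \<delta> \<le> max C 1 * (\<Omega> f \<delta> + \<Omega> g \<delta>)" if "\<delta> > 0" for f g \<delta>
    proof -
      have "0 \<le> \<Omega> f \<delta> + \<Omega> g \<delta>"
        using assms(1) that unfolding modulus_nonneg_def by simp
      then show ?thesis
        using C [OF that, of f g] mult_right_mono [OF max.cobounded1] order_trans by blast
    qed
  qed simp
qed

lemma modulus_doublingE:
  assumes "modulus_nonneg \<Omega>" "modulus_doubling \<Omega>"
  obtains C where "C > 0" "\<And>f \<delta>. \<delta> > 0 \<Longrightarrow> \<Omega> f (2 * \<delta>) \<le> C * \<Omega> f \<delta>"
proof -
  obtain C where C: "\<And>f \<delta>. \<delta> > 0 \<Longrightarrow> \<Omega> f (2 * \<delta>) \<le> C * \<Omega> f \<delta>"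
    using assms(2) unfolding modulus_doubling_def by blast
  show ?thesis
  proof (rule that [of "max C 1"])
    show "\<Omega> f (2 * \<delta>) \<le> max C 1 * \<Omega> f \<delta>" if "\<delta> > 0" for f \<delta>
    proof -
      have "0 \<le> \<Omega> f \<delta>"
        using assms(1) that unfolding modulus_nonneg_def by simp
      then show ?thesis
        using C [OF that, of f] mult_right_mono [OF max.cobounded1] order_trans by blast
    qed
  qed simp
qed

text \<open>Only dyadic indices matter below; \<open>2 ^ n\<close> is at least 1 even for
  \<open>n = 0\<close>, so the side condition disappears.\<close>

lemma jackson_typeE:
  assumes "modulus_nonneg \<Omega>" "jackson_type N \<Omega> P"
  obtains C where "C > 0" "\<And>f n. N (f - P (2 ^ n) f) \<le> C * \<Omega> f (1 / 2 ^ n)"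
proof -
  obtain C where C: "\<And>f n. n \<ge> 1 \<Longrightarrow> N (f - P n f) \<le> C * \<Omega> f (1 / real n)"
    using assms(2) unfolding jackson_type_def by blast
  show ?thesis
  proof (rule that [of "max C 1"])
    show "N (f - P (2 ^ n) f) \<le> max C 1 * \<Omega> f (1 / 2 ^ n)" for f n
    proof -
      have "N (f - P (2 ^ n) f) \<le> C * \<Omega> f (1 / 2 ^ n)"
        using C [of "2 ^ n" f] by simp
      also have "\<dots> \<le> max C 1 * \<Omega> f (1 / 2 ^ n)"
        using assms(1) unfolding modulus_nonneg_def by (intro mult_right_mono) simp_all
      finally show ?thesis .
    qed
  qed simp
qed

lemma modulus_approximant_le:
  assumes N: "abstract_norm lam N" and nonneg: "modulus_nonneg \<Omega>"
    and "modulus_bounded N \<Omega>" "modulus_quasi_additive \<Omega>" "jackson_type N \<Omega> P"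
  shows "\<exists>c>0. \<forall>f n. c * \<Omega> (P (2 ^ n) f) (1 / 2 ^ n) \<le> \<Omega> f (1 / 2 ^ n)"
proof -
  obtain A where A: "A > 0" "\<And>f \<delta>. \<delta> > 0 \<Longrightarrow> \<Omega> f \<delta> \<le> A * N f"
    using modulus_boundedE assms by metis
  obtain B where B: "B > 0" "\<And>f g \<delta>. \<delta> > 0 \<Longrightarrow> \<Omega> (f + g) \<delta> \<le> B * (\<Omega> f \<delta> + \<Omega> g \<delta>)"
    using modulus_quasi_additiveE assms by metis
  obtain J where J: "J > 0" "\<And>f n. N (f - P (2 ^ n) f) \<le> J * \<Omega> f (1 / 2 ^ n)"
    using jackson_typeE assms by metis
  define K where "K = B * (1 + A * J)"
  have "K > 0"
    unfolding K_def using A(1) B(1) J(1) by (simp add: add_pos_pos)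
  have bound: "\<Omega> (P (2 ^ n) f) (1 / 2 ^ n) \<le> K * \<Omega> f (1 / 2 ^ n)" for f n
  proof -
    \<comment> \<open>Boundedness by the norm and the Jackson inequality meet here; symmetry of
      \<open>N\<close> reconciles the two orders of the difference.\<close>
    have "\<Omega> (P (2 ^ n) f - f) (1 / 2 ^ n) \<le> A * N (f - P (2 ^ n) f)"
      using A(2) abstract_norm_minus_commute [OF N, of f] by simp
    also have "\<dots> \<le> A * (J * \<Omega> f (1 / 2 ^ n))"
      using A(1) J(2) by simp
    finally have "\<Omega> f (1 / 2 ^ n) + \<Omega> (P (2 ^ n) f - f) (1 / 2 ^ n)
        \<le> (1 + A * J) * \<Omega> f (1 / 2 ^ n)"
      by (simp add: algebra_simps)
    then have "B * (\<Omega> f (1 / 2 ^ n) + \<Omega> (P (2 ^ n) f - f) (1 / 2 ^ n))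
        \<le> K * \<Omega> f (1 / 2 ^ n)"
      unfolding K_def mult.assoc using B(1) by simp
    then show ?thesis
      using B(2) [of "1 / 2 ^ n" f "P (2 ^ n) f - f"] by simp
  qed
  have "inverse K * \<Omega> (P (2 ^ n) f) (1 / 2 ^ n) \<le> \<Omega> f (1 / 2 ^ n)" for f n
    using bound [where f = f and n = n] \<open>K > 0\<close> by (simp add: field_simps)
  then show ?thesis
    using \<open>K > 0\<close> by (intro exI [of _ "inverse K"]) simp
qed

lemma jackson_error_tendsto_0:
  assumes "abstract_norm lam N" "modulus_nonneg \<Omega>" "modulus_vanishes \<Omega>" "jackson_type N \<Omega> P"
  shows "(\<lambda>m. N (f - P (2 ^ m) f)) \<longlonglongrightarrow> 0"
proof -
  obtain J where J: "\<And>f n. N (f - P (2 ^ n) f) \<le> J * \<Omega> f (1 / 2 ^ n)"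
    using jackson_typeE assms by metis
  have "(\<lambda>m. 1 / 2 ^ m :: real) \<longlonglongrightarrow> 0"
    using LIMSEQ_power_zero [of "1 / 2 :: real"] by (simp add: power_one_over)
  \<comment> \<open>Condition (1) is a one-sided limit, so besides convergence the positivity of the
    sequence is needed.\<close>
  then have "filterlim (\<lambda>m. 1 / 2 ^ m :: real) (at_right 0) sequentially"
    by (simp add: filterlim_at)
  moreover have "(\<Omega> f \<longlongrightarrow> 0) (at_right 0)"
    using assms(3) by (simp add: modulus_vanishes_def)
  ultimately have "(\<lambda>m. \<Omega> f (1 / 2 ^ m)) \<longlonglongrightarrow> 0"
    by (rule filterlim_compose [rotated])
  then have "(\<lambda>m. J * \<Omega> f (1 / 2 ^ m)) \<longlonglongrightarrow> 0"
    by (rule tendsto_mult_right_zero)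
  then show ?thesis
    by (rule tendsto_sandwich [OF _ _ tendsto_const, rotated 2])
      (simp_all add: J abstract_norm_nonneg [OF assms(1)])
qed

text \<open>Quantifying over an arbitrary bound \<open>s\<close> of the partial sums keeps the
  argument within the reals: for a divergent series no such \<open>s\<close> exists and the claim is
  vacuous. The infinite sum enters only through \<open>ennreal_le_infsum_powrI\<close>.\<close>

lemma modulus_le_tail_sums:
  assumes "lam > 0" and N: "abstract_norm lam N" and nonneg: "modulus_nonneg \<Omega>"
    and vanishes: "modulus_vanishes \<Omega>" and "modulus_bounded N \<Omega>" "modulus_quasi_additive \<Omega>"
    and "modulus_doubling \<Omega>" and near: "near_best N P" and jackson: "jackson_type N \<Omega> P"
  shows "\<exists>C>0. \<forall>f n s.
    (\<forall>m. (\<Sum>k=n + 1..m. \<Omega> (P (2 ^ k) f) (1 / 2 ^ k) powr lam) \<le> s) \<longrightarrow>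
    \<Omega> f (1 / 2 ^ n) \<le> C * s powr (1 / lam)"
proof -
  obtain A where A: "A > 0" "\<And>f \<delta>. \<delta> > 0 \<Longrightarrow> \<Omega> f \<delta> \<le> A * N f"
    using modulus_boundedE assms by metis
  obtain B where B: "B > 0" "\<And>f g \<delta>. \<delta> > 0 \<Longrightarrow> \<Omega> (f + g) \<delta> \<le> B * (\<Omega> f \<delta> + \<Omega> g \<delta>)"
    using modulus_quasi_additiveE assms by metis
  obtain D where D: "D > 0" "\<And>f \<delta>. \<delta> > 0 \<Longrightarrow> \<Omega> f (2 * \<delta>) \<le> D * \<Omega> f \<delta>"
    using modulus_doublingE assms by metis
  obtain J where J: "J > 0" "\<And>f n. N (f - P (2 ^ n) f) \<le> J * \<Omega> f (1 / 2 ^ n)"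
    using jackson_typeE assms by metis
  \<comment> \<open>\<open>J\<close> comes from Jackson at scale \<open>1 / 2 ^ k\<close>,
    \<open>D\<close> from passing to the next finer scale, at which the terms of the series are
    taken.\<close>
  define K where "K = J * D"
  have "K > 0"
    unfolding K_def using J(1) D(1) by simp
  have halve: "\<Omega> g (1 / 2 ^ k) \<le> D * \<Omega> g (1 / 2 ^ Suc k)" for g k
    using D(2) [of "1 / 2 ^ Suc k" g] by simp
  have nn: "\<Omega> g (1 / 2 ^ k) \<ge> 0" for g k
    using nonneg by (simp add: modulus_nonneg_def)
  \<comment> \<open>In the constant, \<open>A * K\<close> accounts for the approximation error and 1
    for the first term of the series; \<open>B\<close> is the price of splitting \<open>f\<close>,
    \<open>D\<close> that of halving the scale.\<close>
  have main: "\<Omega> f (1 / 2 ^ n) \<le> D * (B * (A * K + 1)) * s powr (1 / lam)"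
    if s: "\<And>m. (\<Sum>k=n + 1..m. \<Omega> (P (2 ^ k) f) (1 / 2 ^ k) powr lam) \<le> s" for f n s
  proof -
    define a where "a k = \<Omega> (P (2 ^ k) f) (1 / 2 ^ k)" for k
    define e where "e k = N (f - P (2 ^ k) f)" for k
    have e_nn: "e k \<ge> 0" and a_nn: "a k \<ge> 0" for k
      by (simp_all add: e_def a_def nn abstract_norm_nonneg [OF N])
    have error_step: "e k powr lam \<le> e (Suc k) powr lam + (K * a (Suc k)) powr lam" for k
    proof -
      define g where "g = P (2 ^ Suc k) f"
      \<comment> \<open>Condition (5) at index \<open>2 ^ k\<close>: twice this index is
        \<open>2 ^ Suc k\<close>, so the inner approximant is exactly \<open>g\<close>.\<close>
      have "e k \<le> N (f - P (2 ^ k) g)"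
        using near unfolding near_best_def e_def g_def by simp
      then have "e k powr lam \<le> N ((f - g) + (g - P (2 ^ k) g)) powr lam"
        using e_nn \<open>lam > 0\<close> by (intro powr_mono2) simp_all
      also have "\<dots> \<le> N (f - g) powr lam + N (g - P (2 ^ k) g) powr lam"
        by (rule abstract_norm_triangle [OF N])
      also have "N (f - g) = e (Suc k)"
        by (simp add: e_def g_def)
      also have "N (g - P (2 ^ k) g) powr lam \<le> (K * a (Suc k)) powr lam"
      proof (intro powr_mono2)
        have "N (g - P (2 ^ k) g) \<le> J * \<Omega> g (1 / 2 ^ k)"
          by (rule J(2))
        also have "\<dots> \<le> J * (D * \<Omega> g (1 / 2 ^ Suc k))"
          using J(1) halve [of g k] by (intro mult_left_mono) simp_all
        finally show "N (g - P (2 ^ k) g) \<le> K * a (Suc k)"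
          by (simp add: K_def a_def g_def)
      qed (use \<open>lam > 0\<close> abstract_norm_nonneg [OF N] in simp_all)
      finally show ?thesis by simp
    qed
    \<comment> \<open>The step from \<open>e k\<close> to \<open>e (Suc k)\<close> costs the term
      with index \<open>Suc k\<close>; starting from \<open>Suc n\<close>, the sum therefore begins
      at \<open>n + 2\<close> and is empty in the base case.\<close>
    have telescope: "e (Suc n) powr lam
        \<le> e m powr lam + K powr lam * (\<Sum>k=Suc (Suc n)..m. a k powr lam)"
      if "Suc n \<le> m" for m
      using that
    proof (induction m rule: dec_induct)
      case base
      then show ?case by simp
    next
      case (step m)
      then show ?case
        using error_step [of m] \<open>K > 0\<close> a_nn
        by (simp add: powr_mult algebra_simps)
    qed
    \<comment> \<open>The second summand no longer depends on \<open>m\<close>, so \<open>m\<close>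
      can tend to infinity and the first one drops out.\<close>
    have "e (Suc n) powr lam \<le> e m powr lam + K powr lam * s" if "Suc n \<le> m" for m
    proof -
      have "(\<Sum>k=Suc (Suc n)..m. a k powr lam) \<le> (\<Sum>k=n + 1..m. a k powr lam)"
        by (intro sum_mono2) auto
      also have "\<dots> \<le> s"
        using s by (simp add: a_def)
      finally have "K powr lam * (\<Sum>k=Suc (Suc n)..m. a k powr lam) \<le> K powr lam * s"
        by (intro mult_left_mono) simp_all
      with telescope [OF that] show ?thesis by linarith
    qed
    moreover have "(\<lambda>m. e m powr lam + K powr lam * s) \<longlonglongrightarrow> K powr lam * s"
    proof -
      have "e \<longlonglongrightarrow> 0"
        unfolding e_def by (rule jackson_error_tendsto_0 [OF N nonneg vanishes jackson])
      \<comment> \<open>Continuity of the power at base 0 relies on the positive exponent and on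
        \<open>e\<close> being nonnegative.\<close>
      then have "(\<lambda>m. e m powr lam) \<longlonglongrightarrow> 0 powr lam"
        using \<open>lam > 0\<close> e_nn by (intro tendsto_powr') auto
      then show ?thesis
        using tendsto_add [OF _ tendsto_const] by fastforce
    qed
    ultimately have e_le: "e (Suc n) powr lam \<le> K powr lam * s"
      by (intro LIMSEQ_le_const) auto
    \<comment> \<open>For \<open>m = Suc n\<close> the partial sum is this single term. It also
      shows that \<open>s\<close>, so far an arbitrary real, is nonnegative.\<close>
    have a_le: "a (Suc n) powr lam \<le> s"
      using s [of "Suc n"] by (simp add: a_def)
    then have "s \<ge> 0"
      using powr_ge_zero order_trans by blast
    have root_le: "x \<le> y powr (1 / lam)" if "x powr lam \<le> y" "x \<ge> 0" for x y :: real
      using powr_mono2 [of "1 / lam" "x powr lam" y] that \<open>lam > 0\<close> by (simp add: powr_powr)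
    have "e (Suc n) \<le> K * s powr (1 / lam)"
      using root_le [OF e_le e_nn] \<open>K > 0\<close> \<open>s \<ge> 0\<close> \<open>lam > 0\<close> by (simp add: powr_mult powr_powr)
    then have 1: "A * e (Suc n) \<le> A * (K * s powr (1 / lam))"
      using A(1) by simp
    have 2: "a (Suc n) \<le> s powr (1 / lam)"
      by (rule root_le [OF a_le a_nn])
    have 3: "\<Omega> (f - P (2 ^ Suc n) f) (1 / 2 ^ Suc n) \<le> A * e (Suc n)"
      unfolding e_def by (rule A(2)) simp
    \<comment> \<open>The series starts at \<open>n + 1\<close>, so the scale is halved first; then
      \<open>f\<close> is split into its error and its approximant at level
      \<open>Suc n\<close>.\<close>
    have "\<Omega> f (1 / 2 ^ n) \<le> D * \<Omega> f (1 / 2 ^ Suc n)"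
      by (rule halve)
    also have "\<Omega> f (1 / 2 ^ Suc n)
        \<le> B * (\<Omega> (f - P (2 ^ Suc n) f) (1 / 2 ^ Suc n) + a (Suc n))"
      using B(2) [of "1 / 2 ^ Suc n" "f - P (2 ^ Suc n) f" "P (2 ^ Suc n) f"] by (simp add: a_def)
    also have "\<dots> \<le> B * ((A * K + 1) * s powr (1 / lam))"
      using B(1) 1 2 3 by (intro mult_left_mono) (simp_all add: algebra_simps)
    finally show ?thesis
      using D(1) by (simp add: mult.assoc)
  qed
  have "D * (B * (A * K + 1)) > 0"
    using A(1) B(1) D(1) \<open>K > 0\<close> by (simp add: add_pos_pos)
  with main show ?thesis by blast
qed

text \<open>If the sum is infinite, so is the right-hand side, because \<open>C > 0\<close>.
  Otherwise its real value bounds every partial sum and can serve as \<open>s\<close>.\<close>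

lemma ennreal_le_infsum_powrI:
  fixes a :: "nat \<Rightarrow> real"
  assumes "C > 0" and a_nn: "\<And>k. a k \<ge> 0"
    and bound: "\<And>s. (\<And>m. (\<Sum>k=n..m. a k) \<le> s) \<Longrightarrow> w \<le> C * s powr p"
  shows "ennreal w \<le> ennreal C * ennreal_powr (\<Sum>\<^sub>\<infinity>k\<in>{n..}. ennreal (a k)) p"
proof (cases "(\<Sum>\<^sub>\<infinity>k\<in>{n..}. ennreal (a k)) = top")
  case True
  then show ?thesis
    using \<open>C > 0\<close> by (simp add: ennreal_powr_def ennreal_mult_top)
next
  case False
  let ?S = "\<Sum>\<^sub>\<infinity>k\<in>{n..}. ennreal (a k)"
  have "(\<Sum>k=n..m. a k) \<le> enn2real ?S" for m
  proof -
    have "ennreal (\<Sum>k=n..m. a k) = (\<Sum>k=n..m. ennreal (a k))"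
      using a_nn by (simp add: sum_ennreal)
    also have "\<dots> \<le> ?S"
      \<comment> \<open>The sum of nonnegative terms is the supremum over finite subsets, of which
        \<open>{n..m}\<close> is one.\<close>
      by (subst nonneg_infsum_complete) (auto intro!: SUP_upper)
    finally have "enn2real (ennreal (\<Sum>k=n..m. a k)) \<le> enn2real ?S"
      \<comment> \<open>Finiteness is essential: \<open>enn2real\<close> sends \<open>top\<close> to
        0 and is monotone only below \<open>top\<close>.\<close>
      using False by (intro enn2real_mono) (simp_all add: top.not_eq_extremum)
    then show ?thesis
      using a_nn by (simp add: sum_nonneg)
  qed
  then have "ennreal w \<le> ennreal (C * enn2real ?S powr p)"
    by (intro ennreal_leI bound)
  then show ?thesis
    using False \<open>C > 0\<close> by (simp add: ennreal_powr_def ennreal_mult)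
qed

theorem theorem4p1:
  fixes lam :: real
    and N :: "'a::ab_group_add \<Rightarrow> real"
    and \<Omega> :: "'a \<Rightarrow> real \<Rightarrow> real"
    and P :: "nat \<Rightarrow> 'a \<Rightarrow> 'a"
  assumes "lam > 0"
    and "abstract_norm lam N"
    and "modulus_nonneg \<Omega>"
  shows
    "(modulus_vanishes \<Omega> \<and> modulus_bounded N \<Omega> \<and> modulus_quasi_additive \<Omega> \<and>
      modulus_doubling \<Omega> \<and> near_best N P \<and> jackson_type N \<Omega> P \<longrightarrow>
      (\<exists>c C. c > 0 \<and> C > 0 \<and> (\<forall>f n. n \<ge> 1 \<longrightarrow>
         c * \<Omega> (P (2 ^ n) f) (1 / 2 ^ n) \<le> \<Omega> f (1 / 2 ^ n) \<and>
         ennreal (\<Omega> f (1 / 2 ^ n)) \<le>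
           ennreal C * ennreal_powr
             (\<Sum>\<^sub>\<infinity>k\<in>{n + 1..}. ennreal (\<Omega> (P (2 ^ k) f) (1 / 2 ^ k) powr lam)) (1 / lam))))
     \<and>
     (modulus_bounded N \<Omega> \<and> modulus_quasi_additive \<Omega> \<and> jackson_type N \<Omega> P \<longrightarrow>
      (\<exists>c. c > 0 \<and> (\<forall>f n. n \<ge> 1 \<longrightarrow>
         c * \<Omega> (P (2 ^ n) f) (1 / 2 ^ n) \<le> \<Omega> f (1 / 2 ^ n))))"
proof -
  note N = assms(2) and nonneg = assms(3)
  show ?thesis
  proof (intro conjI impI; elim conjE)
    assume "modulus_bounded N \<Omega>" "modulus_quasi_additive \<Omega>" "jackson_type N \<Omega> P"
    then show "\<exists>c. c > 0 \<and> (\<forall>f n. n \<ge> 1 \<longrightarrow>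
        c * \<Omega> (P (2 ^ n) f) (1 / 2 ^ n) \<le> \<Omega> f (1 / 2 ^ n))"
      using modulus_approximant_le [OF N nonneg] by blast
  next
    assume cond: "modulus_vanishes \<Omega>" "modulus_bounded N \<Omega>" "modulus_quasi_additive \<Omega>"
      "modulus_doubling \<Omega>" "near_best N P" "jackson_type N \<Omega> P"
    obtain c where c: "c > 0" "\<And>f n. c * \<Omega> (P (2 ^ n) f) (1 / 2 ^ n) \<le> \<Omega> f (1 / 2 ^ n)"
      using modulus_approximant_le [OF N nonneg cond(2,3,6)] by blast
    obtain C where C: "C > 0" "\<And>f n s.
        (\<And>m. (\<Sum>k=n + 1..m. \<Omega> (P (2 ^ k) f) (1 / 2 ^ k) powr lam) \<le> s) \<Longrightarrow>
        \<Omega> f (1 / 2 ^ n) \<le> C * s powr (1 / lam)"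
      using modulus_le_tail_sums [OF assms cond] by blast
    show "\<exists>c C. c > 0 \<and> C > 0 \<and> (\<forall>f n. n \<ge> 1 \<longrightarrow>
         c * \<Omega> (P (2 ^ n) f) (1 / 2 ^ n) \<le> \<Omega> f (1 / 2 ^ n) \<and>
         ennreal (\<Omega> f (1 / 2 ^ n)) \<le>
           ennreal C * ennreal_powr
             (\<Sum>\<^sub>\<infinity>k\<in>{n + 1..}. ennreal (\<Omega> (P (2 ^ k) f) (1 / 2 ^ k) powr lam)) (1 / lam))"
      using c C by (intro exI [of _ c] exI [of _ C] conjI allI impI ennreal_le_infsum_powrI) auto
  qed
qed

end
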